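(* Let $C$ be a commutative ring with unity, let $n \geq 2$, and let $\mathcal{M}_n(C)$ be the full matrix algebra of all $n\times n$ matrices over $C$. Then every Jordan derivation $D:\mathcal{M}_n(C)\to\mathcal{M}_n(C)$ is a derivation.
   Context: Let $T$ be an algebra over a commutative ring $C$ with unity. A map $D:T\to T$ is a Jordan derivation if it is $C$-linear and $D(a^2)=D(a)a+aD(a)$ for all $a\in T$. A $C$-linear map $D:T\to T$ is a derivation if $D(ab)=D(a)b+aD(b)$ for all $a,b\in T$. The ring $C$ is not assumed to be $2$-torsion free. *)

theory Defs
  imports "Jordan_Normal_Form.Matrix"
begin

text \<open>
  The algebra is given by its carrier \<open>T\<close> and its scalar multiplication \<open>s\<close>; sum and product are
  those of the type. The carrier is needed because square matrices of a fixed size form a proper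
  subset of the type of all matrices. The scalars are all elements of their type.
\<close>

definition linear_endo_on ::
    "('c \<Rightarrow> 't \<Rightarrow> 't) \<Rightarrow> 't set \<Rightarrow> ('t :: plus \<Rightarrow> 't) \<Rightarrow> bool" where
  "linear_endo_on s T D \<longleftrightarrow>
     D \<in> T \<rightarrow> T \<and>
     (\<forall>a\<in>T. \<forall>b\<in>T. D (a + b) = D a + D b) \<and>
     (\<forall>c. \<forall>a\<in>T. D (s c a) = s c (D a))"

definition jordan_derivation_on ::
    "('c \<Rightarrow> 't \<Rightarrow> 't) \<Rightarrow> 't set \<Rightarrow> ('t :: {plus, times} \<Rightarrow> 't) \<Rightarrow> bool" where
  "jordan_derivation_on s T D \<longleftrightarrow>
     linear_endo_on s T D \<and> (\<forall>a\<in>T. D (a * a) = D a * a + a * D a)"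

definition derivation_on ::
    "('c \<Rightarrow> 't \<Rightarrow> 't) \<Rightarrow> 't set \<Rightarrow> ('t :: {plus, times} \<Rightarrow> 't) \<Rightarrow> bool" where
  "derivation_on s T D \<longleftrightarrow>
     linear_endo_on s T D \<and> (\<forall>a\<in>T. \<forall>b\<in>T. D (a * b) = D a * b + a * D b)"

end

theory Submission
  imports Defs
begin

text \<open>
  The defect \<open>f a b = D (a * b) - D a * b - a * D b\<close> of a Jordan derivation is an alternating
  Hochschild 2-cocycle. Evaluating the cocycle identity at matrix units forces such a cocycle to
  vanish: first \<open>f e b = 0\<close> for every diagonal unit \<open>e\<close>; then \<open>f\<close> is balanced over the diagonal
  units, so \<open>f u v = 0\<close> unless both products \<open>u * v\<close> and \<open>v * u\<close> of matrix units are nonzero,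
  and in that last case either \<open>u = v\<close> is diagonal or antisymmetry puts \<open>f u v\<close> into two different
  diagonal Peirce corners.
  Only alternation \<open>f a a = 0\<close> is used, never division by 2.
\<close>

section \<open>Matrix units and induction along them\<close>

definition unit_mat :: "nat \<Rightarrow> nat \<Rightarrow> nat \<Rightarrow> 'a :: {zero, one} mat" where
  "unit_mat n i j = mat n n (\<lambda>(k, l). if k = i \<and> l = j then 1 else 0)"

lemma unit_mat_carrier [simp]: "unit_mat n i j \<in> carrier_mat n n"
  and dim_unit_mat [simp]: "dim_row (unit_mat n i j) = n" "dim_col (unit_mat n i j) = n"
  by (simp_all add: unit_mat_def)

lemma index_unit_mat [simp]:
  "k < n \<Longrightarrow> l < n \<Longrightarrow> unit_mat n i j $$ (k, l) = (if k = i \<and> l = j then 1 else 0)"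
  by (simp add: unit_mat_def)

lemma index_unit_mat_mult:
  fixes X :: "'a :: {comm_ring, comm_monoid_mult} mat"
  assumes "X \<in> carrier_mat n n" "j < n" "k < n" "l < n"
  shows "(unit_mat n i j * X) $$ (k, l) = (if k = i then X $$ (j, l) else 0)"
proof -
  have "(unit_mat n i j * X) $$ (k, l) = (\<Sum>m\<in>{0..<n}. unit_mat n i j $$ (k, m) * X $$ (m, l))"
    using assms by (simp add: scalar_prod_def)
  also have "\<dots> = (\<Sum>m\<in>{0..<n}. if m = j then (if k = i then X $$ (j, l) else 0) else 0)"
    using assms by (intro sum.cong) auto
  finally show ?thesis using assms by simp
qed

lemma index_mult_unit_mat:
  fixes X :: "'a :: {comm_ring, comm_monoid_mult} mat"
  assumes "X \<in> carrier_mat n n" "i < n" "k < n" "l < n"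
  shows "(X * unit_mat n i j) $$ (k, l) = (if l = j then X $$ (k, i) else 0)"
proof -
  have "(X * unit_mat n i j) $$ (k, l) = (\<Sum>m\<in>{0..<n}. X $$ (k, m) * unit_mat n i j $$ (m, l))"
    using assms by (simp add: scalar_prod_def)
  also have "\<dots> = (\<Sum>m\<in>{0..<n}. if m = i then (if l = j then X $$ (k, i) else 0) else 0)"
    using assms by (intro sum.cong) auto
  finally show ?thesis using assms by simp
qed

lemma unit_mat_mult_unit_mat:
  assumes "j < n" "k < n"
  shows "(unit_mat n i j :: 'a :: {comm_ring, comm_monoid_mult} mat) * unit_mat n k l =
    (if j = k then unit_mat n i l else 0\<^sub>m n n)"
  by (rule eq_matI) (use assms in \<open>auto simp: index_unit_mat_mult simp del: index_mult_mat(1)\<close>)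

text \<open>A matrix is the sum of its entries times the matrix units; \<open>zero\<close> covers
  the empty sum.\<close>

lemma unit_mat_induct:
  fixes A :: "'a :: {comm_ring, comm_monoid_mult} mat"
  assumes A: "A \<in> carrier_mat n n"
    and zero: "P (0\<^sub>m n n)"
    and add: "\<And>X Y. X \<in> carrier_mat n n \<Longrightarrow> Y \<in> carrier_mat n n \<Longrightarrow> P X \<Longrightarrow> P Y \<Longrightarrow> P (X + Y)"
    and unit: "\<And>c i j. i < n \<Longrightarrow> j < n \<Longrightarrow> P (c \<cdot>\<^sub>m unit_mat n i j)"
  shows "P A"
proof -
  \<comment> \<open>\<open>R S\<close> grows from the zero matrix to \<open>A\<close> as the
    positions are inserted into \<open>S\<close> one by one.\<close>
  define R where "R S = mat n n (\<lambda>p. if p \<in> S then A $$ p else 0)" for S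
  have "P (R S)" if "finite S" "S \<subseteq> {..<n} \<times> {..<n}" for S
    using that
  proof (induction S rule: finite_induct)
    case empty
    have "R {} = 0\<^sub>m n n" by (rule eq_matI) (auto simp: R_def)
    then show ?case using zero by simp
  next
    case (insert p S)
    obtain i j where p: "p = (i, j)" by fastforce
    have ij: "i < n" "j < n" using insert.prems p by auto
    have "R (insert p S) = R S + A $$ (i, j) \<cdot>\<^sub>m unit_mat n i j"
      by (rule eq_matI) (use insert.hyps p in \<open>auto simp: R_def\<close>)
    moreover have "P (R S + A $$ (i, j) \<cdot>\<^sub>m unit_mat n i j)"
      using insert ij by (intro add unit) (auto simp: R_def)
    ultimately show ?case by simp
  qed
  from this[of "{..<n} \<times> {..<n}"] have "P (R ({..<n} \<times> {..<n}))" by simp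
  moreover have "R ({..<n} \<times> {..<n}) = A"
    by (rule eq_matI) (use A in \<open>auto simp: R_def\<close>)
  ultimately show ?thesis by simp
qed

section \<open>Alternating 2-cocycles on the matrix algebra\<close>

locale alternating_mat_cocycle =
  fixes n :: nat
    and f :: "'a :: {comm_ring, comm_monoid_mult} mat \<Rightarrow> 'a mat \<Rightarrow> 'a mat"
  assumes closed [simp]:
      "a \<in> carrier_mat n n \<Longrightarrow> b \<in> carrier_mat n n \<Longrightarrow> f a b \<in> carrier_mat n n"
    and add_left: "a \<in> carrier_mat n n \<Longrightarrow> b \<in> carrier_mat n n \<Longrightarrow> c \<in> carrier_mat n n \<Longrightarrow>
      f (a + b) c = f a c + f b c"
    and add_right: "a \<in> carrier_mat n n \<Longrightarrow> b \<in> carrier_mat n n \<Longrightarrow> c \<in> carrier_mat n n \<Longrightarrow>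
      f a (b + c) = f a b + f a c"
    and smult_right: "a \<in> carrier_mat n n \<Longrightarrow> b \<in> carrier_mat n n \<Longrightarrow>
      f a (x \<cdot>\<^sub>m b) = x \<cdot>\<^sub>m f a b"
    and alternating: "a \<in> carrier_mat n n \<Longrightarrow> f a a = 0\<^sub>m n n"
    and cocycle: "a \<in> carrier_mat n n \<Longrightarrow> b \<in> carrier_mat n n \<Longrightarrow> c \<in> carrier_mat n n \<Longrightarrow>
      a * f b c + f a (b * c) = f (a * b) c + f a b * c"
begin

abbreviation "E \<equiv> unit_mat n"

lemma dim_f [simp]:
  assumes "a \<in> carrier_mat n n" "b \<in> carrier_mat n n"
  shows "dim_row (f a b) = n" "dim_col (f a b) = n"
  using closed[OF assms] by auto

text \<open>Polarisation: expand \<open>f (a + b) (a + b)\<close>. The comparison is entrywise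
  because entries lie in a ring, while matrices form an additive group only at fixed
  dimensions.\<close>

lemma antisym:
  assumes a: "a \<in> carrier_mat n n" and b: "b \<in> carrier_mat n n"
  shows "f a b = - f b a"
proof (rule eq_matI)
  fix i j assume "i < dim_row (- f b a)" "j < dim_col (- f b a)"
  then have ij: "i < n" "j < n" using a b by auto
  have "f a a + f b a + (f a b + f b b) = 0\<^sub>m n n"
    using alternating[of "a + b"] a b by (simp add: add_left add_right)
  from arg_cong[OF this, of "\<lambda>X. X $$ (i, j)"]
  have "f b a $$ (i, j) + f a b $$ (i, j) = 0"
    using a b ij by (simp add: alternating)
  then show "f a b $$ (i, j) = (- f b a) $$ (i, j)"
    using a b ij by (simp add: eq_neg_iff_add_eq_0 add.commute)
qed (use a b in auto)

lemma zero_right [simp]: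
  assumes "a \<in> carrier_mat n n"
  shows "f a (0\<^sub>m n n) = 0\<^sub>m n n"
proof -
  have "f a (0\<^sub>m n n) = 0 \<cdot>\<^sub>m f a (0\<^sub>m n n)"
    using smult_right[of a "0\<^sub>m n n" 0] assms by simp
  also have "\<dots> = 0\<^sub>m n n" by (rule eq_matI) (use assms in auto)
  finally show ?thesis .
qed

lemma zero_left [simp]: "a \<in> carrier_mat n n \<Longrightarrow> f (0\<^sub>m n n) a = 0\<^sub>m n n"
  using antisym[of "0\<^sub>m n n" a] by (auto intro!: eq_matI)

lemma antisym_index:
  assumes "a \<in> carrier_mat n n" "b \<in> carrier_mat n n" "i < n" "j < n"
  shows "f a b $$ (i, j) = - f b a $$ (i, j)"
  using antisym[of a b] assms by simp

lemma cocycle_index: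
  assumes "a \<in> carrier_mat n n" "b \<in> carrier_mat n n" "c \<in> carrier_mat n n" "i < n" "j < n"
  shows "(a * f b c) $$ (i, j) + f a (b * c) $$ (i, j) =
    f (a * b) c $$ (i, j) + (f a b * c) $$ (i, j)"
  using arg_cong[OF cocycle[of a b c], of "\<lambda>X. X $$ (i, j)"] assms
  by (simp del: index_mult_mat(1))

lemmas unit_simps = unit_mat_mult_unit_mat index_unit_mat_mult index_mult_unit_mat alternating

section \<open>A diagonal unit as one argument\<close>

text \<open>Two instances of the cocycle identity kill complementary columns. The triple
  \<open>E i i\<close>, \<open>E i j\<close>, \<open>E i j\<close> gives
  \<open>f (E i i) (E i j) * E i j = 0\<close>, hence column \<open>i\<close>; the triple
  \<open>E i j\<close>, \<open>E i i\<close>, \<open>E i i\<close> gives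
  \<open>f (E i j) (E i i) = f (E i j) (E i i) * E i i\<close>, hence all other columns.\<close>

lemma diag_unit_row:
  assumes "i < n" "j < n" "i \<noteq> j"
  shows "f (E i i) (E i j) = 0\<^sub>m n n"
proof (rule eq_matI)
  fix p q assume "p < dim_row (0\<^sub>m n n :: 'a mat)" "q < dim_col (0\<^sub>m n n :: 'a mat)"
  then have pq: "p < n" "q < n" by auto
  show "f (E i i) (E i j) $$ (p, q) = 0\<^sub>m n n $$ (p, q)"
  proof (cases "q = i")
    case True
    then show ?thesis
      \<comment> \<open>Right multiplication by \<open>E i j\<close> moves column \<open>i\<close>
        to column \<open>j\<close>, hence the index \<open>j\<close>.\<close>
      using cocycle_index[of "E i i" "E i j" "E i j" p j] assms pq
      by (simp add: unit_simps del: index_mult_mat(1))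
  next
    case False
    then have "f (E i j) (E i i) $$ (p, q) = 0"
      using cocycle_index[of "E i j" "E i i" "E i i" p q] assms pq
      by (simp add: unit_simps del: index_mult_mat(1))
    then show ?thesis using antisym_index[of "E i i" "E i j" p q] pq by simp
  qed
qed auto

text \<open>Mirror image of \<open>diag_unit_row\<close>, with rows in place of columns.\<close>

lemma diag_unit_col:
  assumes "i < n" "j < n" "i \<noteq> j"
  shows "f (E i i) (E j i) = 0\<^sub>m n n"
proof (rule eq_matI)
  fix p q assume "p < dim_row (0\<^sub>m n n :: 'a mat)" "q < dim_col (0\<^sub>m n n :: 'a mat)"
  then have pq: "p < n" "q < n" by auto
  show "f (E i i) (E j i) $$ (p, q) = 0\<^sub>m n n $$ (p, q)"
  proof (cases "p = i")
    case True
    then have "f (E j i) (E i i) $$ (p, q) = 0"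
      using cocycle_index[of "E j i" "E j i" "E i i" j q] assms pq
      by (simp add: unit_simps del: index_mult_mat(1))
    then show ?thesis using antisym_index[of "E i i" "E j i" p q] pq by simp
  next
    case False
    then show ?thesis
      using cocycle_index[of "E i i" "E i i" "E j i" p q] assms pq
      by (simp add: unit_simps del: index_mult_mat(1))
  qed
qed auto

text \<open>As \<open>E i i\<close> annihilates \<open>E k l\<close> on both sides, the cocycle
  identity shows that \<open>E i i\<close> fixes \<open>f (E i i) (E k l)\<close> from the left and
  \<open>f (E k l) (E i i)\<close> from the right.\<close>

lemma diag_unit_off_corner:
  assumes "i < n" "k < n" "l < n" "k \<noteq> i" "l \<noteq> i" "p < n" "q < n" "p \<noteq> i \<or> q \<noteq> i"
  shows "f (E i i) (E k l) $$ (p, q) = 0"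
proof (cases "p = i")
  case True
  then have "f (E k l) (E i i) $$ (p, q) = 0"
    using cocycle_index[of "E k l" "E i i" "E i i" p q] assms
    by (simp add: unit_simps del: index_mult_mat(1))
  then show ?thesis using antisym_index[of "E i i" "E k l" p q] assms by simp
next
  case False
  then show ?thesis
    using cocycle_index[of "E i i" "E i i" "E k l" p q] assms
    by (simp add: unit_simps del: index_mult_mat(1))
qed

lemma diag_unit_outside:
  assumes "i < n" "k < n" "l < n" "k \<noteq> i" "l \<noteq> i"
  shows "f (E i i) (E k l) = 0\<^sub>m n n"
proof (rule eq_matI)
  fix p q assume "p < dim_row (0\<^sub>m n n :: 'a mat)" "q < dim_col (0\<^sub>m n n :: 'a mat)"
  then have pq: "p < n" "q < n" by auto
  have "f (E i i) (E k l) $$ (i, i) = 0"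
  proof (cases "k = l")
    case True
    then show ?thesis
      \<comment> \<open>With the arguments swapped only the entry \<open>(k, k)\<close> can survive,
        and \<open>k \<noteq> i\<close>.\<close>
      using antisym_index[of "E i i" "E k k" i i] diag_unit_off_corner[of k i i i i] assms by simp
  next
    case False
    then show ?thesis
      \<comment> \<open>Split \<open>E k l\<close> as \<open>E k k * E k l\<close>. The term with
        \<open>f (E k k) (E k l)\<close> is zero by \<open>diag_unit_row\<close>, and right
        multiplication by \<open>E k l\<close> fills only column \<open>l\<close>, which is not
        column \<open>i\<close>.\<close>
      using cocycle_index[of "E i i" "E k k" "E k l" i i] assms
      by (simp add: unit_simps diag_unit_row del: index_mult_mat(1))
  qed
  then show "f (E i i) (E k l) $$ (p, q) = 0\<^sub>m n n $$ (p, q)"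
    using diag_unit_off_corner[of i k l p q] assms pq by (cases "p = i \<and> q = i") auto
qed auto

lemma zero_if_zero_on_units:
  assumes a: "a \<in> carrier_mat n n" and b: "b \<in> carrier_mat n n"
    and units: "\<And>k l. k < n \<Longrightarrow> l < n \<Longrightarrow> f a (E k l) = 0\<^sub>m n n"
  shows "f a b = 0\<^sub>m n n"
  using b by (rule unit_mat_induct) (use a units in \<open>auto simp: add_right smult_right\<close>)

lemma diag_unit_left:
  assumes "i < n" "b \<in> carrier_mat n n"
  shows "f (E i i) b = 0\<^sub>m n n"
proof (rule zero_if_zero_on_units)
  fix k l assume "k < n" "l < n"
  then show "f (E i i) (E k l) = 0\<^sub>m n n"
    using assms diag_unit_row[of i l] diag_unit_col[of i k] diag_unit_outside[of i k l]
      alternating[of "E i i"]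
    by (cases "k = i"; cases "l = i") auto
qed (use assms in auto)

lemma diag_unit_right:
  assumes "i < n" "b \<in> carrier_mat n n"
  shows "f b (E i i) = 0\<^sub>m n n"
  using antisym[of b "E i i"] diag_unit_left[OF assms] assms by (auto intro!: eq_matI)

section \<open>From diagonal units to all matrices\<close>

text \<open>With \<open>E i i\<close> in the middle, the outer terms \<open>a * f (E i i) b\<close>
  and \<open>f a (E i i) * b\<close> of the cocycle identity vanish.\<close>

lemma mult_diag_unit_balanced:
  assumes "i < n" "a \<in> carrier_mat n n" "b \<in> carrier_mat n n"
  shows "f (a * E i i) b = f a (E i i * b)"
  using cocycle[of a "E i i" b] assms
  by (simp add: diag_unit_left diag_unit_right left_add_zero_mat[of _ n n] right_add_zero_mat[of _ n n]
    mult_carrier_mat[of _ n n])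

lemma diag_unit_mult_left:
  assumes "i < n" "a \<in> carrier_mat n n" "b \<in> carrier_mat n n"
  shows "f (E i i * a) b = E i i * f a b"
  using cocycle[of "E i i" a b] assms
  by (simp add: diag_unit_left right_add_zero_mat[of _ n n] mult_carrier_mat[of _ n n])

text \<open>Write \<open>E i j\<close> as \<open>E i j * E j j\<close> and shift
  \<open>E j j\<close> to the second argument, where it annihilates \<open>E k l\<close>.\<close>

lemma units_not_composable:
  assumes "i < n" "j < n" "k < n" "l < n" "j \<noteq> k"
  shows "f (E i j) (E k l) = 0\<^sub>m n n"
  using mult_diag_unit_balanced[of j "E i j" "E k l"] assms
  by (simp add: unit_mat_mult_unit_mat)

lemma unit_row_zero:
  assumes "i < n" "j < n" "b \<in> carrier_mat n n" "p < n" "q < n" "p \<noteq> i"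
  shows "f (E i j) b $$ (p, q) = 0"
proof -
  have "f (E i j) b = E i i * f (E i j) b"
    using diag_unit_mult_left[of i "E i j" b] assms by (simp add: unit_mat_mult_unit_mat)
  then have "f (E i j) b $$ (p, q) = (E i i * f (E i j) b) $$ (p, q)" by simp
  then show ?thesis using assms by (simp add: index_unit_mat_mult del: index_mult_mat(1))
qed

lemma units_zero:
  assumes "i < n" "j < n" "k < n" "l < n"
  shows "f (E i j) (E k l) = 0\<^sub>m n n"
proof -
  consider "j \<noteq> k" | "j = k" "l \<noteq> i" | "j = k" "l = i" "i = j" | "j = k" "l = i" "i \<noteq> j"
    by blast
  then show ?thesis
  proof cases
    case 1
    then show ?thesis using assms by (simp add: units_not_composable)
  next
    case 2
    then have "f (E k l) (E i j) = 0\<^sub>m n n" using assms by (simp add: units_not_composable)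
    then show ?thesis using antisym[of "E i j" "E k l"] by (auto intro!: eq_matI)
  next
    case 3
    then show ?thesis by (simp add: alternating)
  next
    case 4
    \<comment> \<open>The value lies in row \<open>i\<close>, and with the arguments swapped in row
      \<open>j\<close>. The two are negatives of each other and the rows differ, so both are
      zero.\<close>
    show ?thesis
    proof (rule eq_matI)
      fix p q assume "p < dim_row (0\<^sub>m n n :: 'a mat)" "q < dim_col (0\<^sub>m n n :: 'a mat)"
      then show "f (E i j) (E k l) $$ (p, q) = 0\<^sub>m n n $$ (p, q)"
        using 4 assms unit_row_zero[of i j "E k l" p q] unit_row_zero[of j i "E i j" p q]
          antisym_index[of "E i j" "E k l" p q]
        by (cases "p = i") auto
    qed auto
  qed
qed

text \<open>Linear extension in the second argument, applied twice with a swap of the arguments in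
  between.\<close>

theorem vanishes:
  assumes a: "a \<in> carrier_mat n n" and b: "b \<in> carrier_mat n n"
  shows "f a b = 0\<^sub>m n n"
proof (rule zero_if_zero_on_units[OF a b])
  fix k l assume kl: "k < n" "l < n"
  have "f (E k l) a = 0\<^sub>m n n"
    by (rule zero_if_zero_on_units) (use a kl units_zero in auto)
  then show "f a (E k l) = 0\<^sub>m n n"
    using antisym[of a "E k l"] a by (auto intro!: eq_matI)
qed

end

text \<open>The defect is minus the Hochschild coboundary of \<open>D\<close>, so associativity
  yields the cocycle identity; alternation is the Jordan identity itself.\<close>

lemma jordan_defect_alternating_cocycle:
  fixes D :: "'a :: {comm_ring, comm_monoid_mult} mat \<Rightarrow> 'a mat"
  assumes D: "jordan_derivation_on (\<cdot>\<^sub>m) (carrier_mat n n) D"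
  shows "alternating_mat_cocycle n (\<lambda>a b. D (a * b) - D a * b - a * D b)"
proof -
  let ?M = "carrier_mat n n :: 'a mat set"
  have [simp]: "a * b \<in> ?M" if "a \<in> ?M" "b \<in> ?M" for a b
    using that by simp
  have [simp]: "D a \<in> ?M" if "a \<in> ?M" for a
    using D that by (auto simp: jordan_derivation_on_def linear_endo_on_def)
  have Da: "D (a + b) = D a + D b" if "a \<in> ?M" "b \<in> ?M" for a b
    using D that by (auto simp: jordan_derivation_on_def linear_endo_on_def)
  have Ds: "D (x \<cdot>\<^sub>m a) = x \<cdot>\<^sub>m D a" if "a \<in> ?M" for x a
    using D that by (auto simp: jordan_derivation_on_def linear_endo_on_def)
  have Dj: "D (a * a) = D a * a + a * D a" if "a \<in> ?M" for a
    using D that by (auto simp: jordan_derivation_on_def)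
  have regroup: "(X + X') - (Y + Y') - (Z + Z') = X - Y - Z + (X' - Y' - Z')"
    if "X \<in> ?M" "X' \<in> ?M" "Y \<in> ?M" "Y' \<in> ?M" "Z \<in> ?M" "Z' \<in> ?M" for X X' Y Y' Z Z'
    by (rule eq_matI) (use that in auto)
  have smult_diff: "x \<cdot>\<^sub>m X - x \<cdot>\<^sub>m Y - x \<cdot>\<^sub>m Z = x \<cdot>\<^sub>m (X - Y - Z)"
    if "X \<in> ?M" "Y \<in> ?M" "Z \<in> ?M" for x X Y Z
    by (rule eq_matI) (use that in \<open>auto simp: right_diff_distrib\<close>)
  \<comment> \<open>\<open>X\<close> and \<open>X'\<close> stand for \<open>a * D (b * c)\<close>
    and \<open>D (a * b) * c\<close>; each cancels on its own side of the cocycle identity.\<close>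
  have cancel: "X - Y - Z + (W - V - X) = W - X' - Z + (X' - V - Y)"
    if "X \<in> ?M" "X' \<in> ?M" "Y \<in> ?M" "Z \<in> ?M" "V \<in> ?M" "W \<in> ?M" for X X' Y Z V W
    by (rule eq_matI) (use that in auto)
  have add_diff: "X + Y - X - Y = 0\<^sub>m n n" if "X \<in> ?M" "Y \<in> ?M" for X Y
    by (rule eq_matI) (use that in auto)
  show ?thesis
  proof
    fix a b :: "'a mat" assume "a \<in> ?M" "b \<in> ?M"
    then show "D (a * b) - D a * b - a * D b \<in> ?M"
      by (intro minus_carrier_mat) simp
  next
    fix a b c :: "'a mat" assume abc: "a \<in> ?M" "b \<in> ?M" "c \<in> ?M"
    show "D ((a + b) * c) - D (a + b) * c - (a + b) * D c =
        D (a * c) - D a * c - a * D c + (D (b * c) - D b * c - b * D c)"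
      using abc by (simp add: add_mult_distrib_mat[of _ n n _ _ n] Da regroup)
    show "D (a * (b + c)) - D a * (b + c) - a * D (b + c) =
        D (a * b) - D a * b - a * D b + (D (a * c) - D a * c - a * D c)"
      using abc by (simp add: mult_add_distrib_mat[of _ n n _ n] Da regroup)
    have "a * (D (b * c) - D b * c - b * D c) = a * D (b * c) - a * D b * c - a * b * D c"
      using abc by (simp add: minus_carrier_mat mult_minus_distrib_mat[of _ n n _ n]
          assoc_mult_mat[of _ n n _ n _ n])
    moreover have "(D (a * b) - D a * b - a * D b) * c = D (a * b) * c - D a * (b * c) - a * D b * c"
      using abc by (simp add: minus_carrier_mat minus_mult_distrib_mat[of _ n n _ _ n]
          assoc_mult_mat[of _ n n _ n _ n])
    moreover have "a * b * c = a * (b * c)"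
      using abc by (simp add: assoc_mult_mat[of _ n n _ n _ n])
    ultimately show "a * (D (b * c) - D b * c - b * D c) +
        (D (a * (b * c)) - D a * (b * c) - a * D (b * c)) =
        D (a * b * c) - D (a * b) * c - a * b * D c + (D (a * b) - D a * b - a * D b) * c"
      using abc by (simp only:) (rule cancel; simp)
  next
    fix a b :: "'a mat" and x assume ab: "a \<in> ?M" "b \<in> ?M"
    then show "D (a * (x \<cdot>\<^sub>m b)) - D a * (x \<cdot>\<^sub>m b) - a * D (x \<cdot>\<^sub>m b) =
        x \<cdot>\<^sub>m (D (a * b) - D a * b - a * D b)"
      by (simp add: mult_smult_distrib[of _ n n _ n] Ds smult_diff)
  next
    fix a :: "'a mat" assume a: "a \<in> ?M"
    show "D (a * a) - D a * a - a * D a = 0\<^sub>m n n"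
      using a by (simp add: Dj add_diff)
  qed
qed

(* The sort {comm_ring, comm_monoid_mult} is that of commutative rings with unity; unlike
   comm_ring_1 it does not exclude the zero ring. *)
theorem theorem3p1:
  fixes D :: "'a :: {comm_ring, comm_monoid_mult} mat \<Rightarrow> 'a mat" and n :: nat
  assumes "n \<ge> 2"
    and "jordan_derivation_on (\<cdot>\<^sub>m) (carrier_mat n n) D"
  shows "derivation_on (\<cdot>\<^sub>m) (carrier_mat n n) D"
proof -
  interpret alternating_mat_cocycle n "\<lambda>a b. D (a * b) - D a * b - a * D b"
    using assms(2) by (rule jordan_defect_alternating_cocycle)
  have lin: "linear_endo_on (\<cdot>\<^sub>m) (carrier_mat n n) D"
    using assms(2) by (simp add: jordan_derivation_on_def)
  have "D (a * b) = D a * b + a * D b" if a: "a \<in> carrier_mat n n" and b: "b \<in> carrier_mat n n" for a b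
  proof (rule eq_matI)
    have D: "D a \<in> carrier_mat n n" "D b \<in> carrier_mat n n" "D (a * b) \<in> carrier_mat n n"
      using lin a b by (auto simp: linear_endo_on_def)
    then show "dim_row (D (a * b)) = dim_row (D a * b + a * D b)"
      and "dim_col (D (a * b)) = dim_col (D a * b + a * D b)"
      using a b by auto
    fix i j assume "i < dim_row (D a * b + a * D b)" "j < dim_col (D a * b + a * D b)"
    then have ij: "i < n" "j < n" using a D by auto
    \<comment> \<open>In the ring of entries the subtracted terms of the vanishing defect can be
      moved across.\<close>
    show "D (a * b) $$ (i, j) = (D a * b + a * D b) $$ (i, j)"
      using arg_cong[OF vanishes[OF a b], of "\<lambda>X. X $$ (i, j)"] a b D ij
      by (simp add: diff_diff_eq del: index_mult_mat(1))
  qed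
  with lin show ?thesis by (simp add: derivation_on_def)
qed

end
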